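(* Let $a\in\mathbb{R}$, $\gamma\in[0,1]$, let $f$ be a real valued function defined on $\mathbb{N}_a=\{a,a+1,a+2,\ldots\}$, and let $\alpha_1,\alpha_2,\beta_1,\beta_2>0$. Then for all $t\in\mathbb{N}_a$, $$\left({}_{\gamma}\diamondsuit_a^{-\alpha_1,-\beta_1}\left({}_{\gamma}\diamondsuit_a^{-\alpha_2,-\beta_2}f\right)\right)(t)=\gamma\left({}_{\gamma}\diamondsuit_a^{-(\alpha_1+\alpha_2),-(\beta_1+\alpha_2)}f\right)(t)+(1-\gamma)\left({}_{\gamma}\diamondsuit_a^{-(\alpha_1+\beta_2),-(\beta_1+\beta_2)}f\right)(t).$$
   Context: For real $\alpha$, $t^{(\alpha)}=\frac{\Gamma(t+1)}{\Gamma(t+1-\alpha)}$ and $t^{\overline{\alpha}}=\frac{\Gamma(t+\alpha)}{\Gamma(t)}$, where $\Gamma$ is the Euler gamma function; $\sigma(s)=s+1$, $\rho(s)=s-1$. For $a\in\mathbb{R}$ and $\mathbb{N}_a=\{a,a+1,a+2,\ldots\}$, a sum $\sum_{s=a}^{b}$ with $b\in\mathbb{N}_a$ runs over $s=a,a+1,\ldots,b$. Delta fractional sum ($\alpha>0$): for $f$ on $\mathbb{N}_a$ and $t\in\mathbb{N}_{a+\alpha}$, $(\Delta_a^{-\alpha}f)(t)=\frac{1}{\Gamma(\alpha)}\sum_{s=a}^{t-\alpha}(t-\sigma(s))^{(\alpha-1)}f(s)$. Nabla fractional sum ($\beta>0$): for $f$ on $\mathbb{N}_a$ and $t\in\mathbb{N}_a$,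 $(\nabla_a^{-\beta}f)(t)=\frac{1}{\Gamma(\beta)}\sum_{s=a}^{t}(t-\rho(s))^{\overline{\beta-1}}f(s)$. Diamond-$\gamma$ fractional sum of order $(\alpha,\beta)$ ($\alpha,\beta>0$, $\gamma\in[0,1]$): for $t\in\mathbb{N}_a$, $\left({}_{\gamma}\diamondsuit_a^{-\alpha,-\beta}f\right)(t)=\gamma(\Delta_a^{-\alpha}f)(t+\alpha)+(1-\gamma)(\nabla_a^{-\beta}f)(t)$. It maps functions on $\mathbb{N}_a$ to functions on $\mathbb{N}_a$. *)

theory Defs
  imports "HOL-Analysis.Analysis"
begin

definition Nat_from :: "real \<Rightarrow> real set" where
  "Nat_from a = {a + real n | n. True}"

(* HOL-Analysis sets Gamma to 0 at its poles. In the fractional sums below, evaluated at the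
   points where they are meant to be used, all arguments of Gamma are positive. *)
definition falling_factorial :: "real \<Rightarrow> real \<Rightarrow> real" where
  "falling_factorial t \<alpha> = Gamma (t + 1) / Gamma (t + 1 - \<alpha>)"

definition rising_factorial :: "real \<Rightarrow> real \<Rightarrow> real" where
  "rising_factorial t \<alpha> = Gamma (t + \<alpha>) / Gamma t"

definition forward_jump :: "real \<Rightarrow> real" where
  "forward_jump s = s + 1"

definition backward_jump :: "real \<Rightarrow> real" where
  "backward_jump s = s - 1"

(* Functions on Nat_from a are represented by total functions on the reals; only their values
   on Nat_from a enter the sums below. The positive parameters \<alpha> and \<beta> stand for the
   orders -\<alpha> and -\<beta>. *)

(* Meant for t in Nat_from (a + \<alpha>). *)
definition delta_sum :: "real \<Rightarrow> real \<Rightarrow> (real \<Rightarrow> real) \<Rightarrow> real \<Rightarrow> real" where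
  "delta_sum a \<alpha> f t =
     1 / Gamma \<alpha> *
     (\<Sum>s\<in>{s \<in> Nat_from a. s \<le> t - \<alpha>}. falling_factorial (t - forward_jump s) (\<alpha> - 1) * f s)"

(* Meant for t in Nat_from a. *)
definition nabla_sum :: "real \<Rightarrow> real \<Rightarrow> (real \<Rightarrow> real) \<Rightarrow> real \<Rightarrow> real" where
  "nabla_sum a \<beta> f t =
     1 / Gamma \<beta> *
     (\<Sum>s\<in>{s \<in> Nat_from a. s \<le> t}. rising_factorial (t - backward_jump s) (\<beta> - 1) * f s)"

definition diamond_sum ::
    "real \<Rightarrow> real \<Rightarrow> real \<Rightarrow> real \<Rightarrow> (real \<Rightarrow> real) \<Rightarrow> real \<Rightarrow> real" where
  "diamond_sum \<gamma> a \<alpha> \<beta> f t = \<gamma> * delta_sum a \<alpha> f (t + \<alpha>) + (1 - \<gamma>) * nabla_sum a \<beta> f t"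

end

theory Submission
  imports Defs
begin

text \<open>
  On the grid \<open>a, a + 1, a + 2, \<dots>\<close> the shift by \<open>\<alpha>\<close> in the delta sum cancels the
  difference between the two factorial powers: both \<open>delta_sum a \<alpha> f (t + \<alpha>)\<close> and
  \<open>nabla_sum a \<alpha> f t\<close> are the discrete convolution of \<open>f\<close> with the kernel
  \<open>\<Gamma> (k + \<alpha>) / (\<Gamma> \<alpha> * k!)\<close>, whose generating function is the binomial series
  \<open>(1 - X) powr (- \<alpha>)\<close> (\<open>delta_sum_conv_fps\<close>, \<open>nabla_sum_conv_fps\<close>). In terms of
  generating functions a diamond sum is therefore multiplication by
  \<open>\<gamma> (1 - X) powr (- \<alpha>) + (1 - \<gamma>) (1 - X) powr (- \<beta>)\<close>.

  These series satisfy the exponent law, which is the Chu-Vandermonde identity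
  (\<open>fps_neg_binomial_add\<close>). Multiplying out the product of two such multipliers in the
  commutative ring of formal power series gives four terms, and grouping them by the inner
  factor \<open>\<gamma>\<close> or \<open>1 - \<gamma>\<close> gives the claimed formula.
\<close>

text \<open>The series \<open>(1 - X) powr (- \<alpha>)\<close>, for an arbitrary real exponent.\<close>

definition fps_neg_binomial :: "real \<Rightarrow> real fps" where
  "fps_neg_binomial \<alpha> = Abs_fps (\<lambda>k. pochhammer \<alpha> k / fact k)"

definition grid_fps :: "real \<Rightarrow> (real \<Rightarrow> real) \<Rightarrow> real fps" where
  "grid_fps a f = Abs_fps (\<lambda>n. f (a + real n))"

text \<open>
  Comparing coefficients, this is Vandermonde's identity for rising factorials, divided by
  \<open>n!\<close>.
\<close>

lemma fps_neg_binomial_add: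
  "fps_neg_binomial (\<alpha> + \<beta>) = fps_neg_binomial \<alpha> * fps_neg_binomial \<beta>"
proof (rule fps_ext)
  fix n
  have "pochhammer (\<alpha> + \<beta>) n / fact n =
          (\<Sum>k\<le>n. of_nat (n choose k) * pochhammer \<alpha> k * pochhammer \<beta> (n - k) / fact n)"
    by (simp add: pochhammer_binomial_sum sum_divide_distrib)
  also have "\<dots> = (\<Sum>k\<le>n. pochhammer \<alpha> k / fact k * (pochhammer \<beta> (n - k) / fact (n - k)))"
    by (rule sum.cong) (simp_all add: binomial_fact)
  finally show "fps_nth (fps_neg_binomial (\<alpha> + \<beta>)) n =
                  fps_nth (fps_neg_binomial \<alpha> * fps_neg_binomial \<beta>) n"
    by (simp add: fps_neg_binomial_def fps_mult_nth atMost_atLeast0)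
qed

lemma fps_neg_binomial_nth_conv_Gamma:
  assumes "\<alpha> > 0"
  shows "fps_nth (fps_neg_binomial \<alpha>) k = Gamma (real k + \<alpha>) / Gamma (real k + 1) / Gamma \<alpha>"
proof -
  have "\<alpha> \<notin> \<int>\<^sub>\<le>\<^sub>0"
    using assms by (auto elim!: nonpos_Ints_cases)
  thus ?thesis
    using Gamma_fact[of k, where ?'a = real]
    by (simp add: fps_neg_binomial_def pochhammer_Gamma add.commute)
qed

lemma sum_Nat_from_upto:
  "(\<Sum>s\<in>{s \<in> Nat_from a. s \<le> a + real n}. g s) = (\<Sum>k\<le>n. g (a + real k))"
proof -
  have "{s \<in> Nat_from a. s \<le> a + real n} = (\<lambda>k. a + real k) ` {..n}"
    by (auto simp: Nat_from_def)
  moreover have "inj_on (\<lambda>k. a + real k) {..n}"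
    by (auto simp: inj_on_def)
  ultimately show ?thesis
    by (simp add: sum.reindex)
qed

lemma grid_fps_mult_nth:
  "fps_nth (F * grid_fps a f) n = (\<Sum>k\<le>n. fps_nth F (n - k) * f (a + real k))"
  unfolding mult.commute[of F] fps_mult_nth
  by (simp add: grid_fps_def atMost_atLeast0 mult.commute)

text \<open>
  In \<open>falling_factorial (n - k + \<alpha> - 1) (\<alpha> - 1)\<close> the two occurrences of \<open>\<alpha>\<close> cancel
  in the denominator, which leaves \<open>\<Gamma> (n - k + \<alpha>) / \<Gamma> (n - k + 1)\<close>, the rising
  factorial power that the nabla sum uses directly.
\<close>

lemma delta_sum_conv_fps:
  assumes "\<alpha> > 0"
  shows "delta_sum a \<alpha> f (a + real n + \<alpha>) = fps_nth (fps_neg_binomial \<alpha> * grid_fps a f) n"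
proof -
  have "1 / Gamma \<alpha> *
          (falling_factorial (a + real n + \<alpha> - forward_jump (a + real k)) (\<alpha> - 1) * y) =
        fps_nth (fps_neg_binomial \<alpha>) (n - k) * y" if "k \<le> n" for k y
    using that
    by (simp add: fps_neg_binomial_nth_conv_Gamma[OF assms] falling_factorial_def
        forward_jump_def of_nat_diff algebra_simps)
  thus ?thesis
    unfolding delta_sum_def add_diff_cancel_right' sum_Nat_from_upto grid_fps_mult_nth sum_distrib_left
    by (intro sum.cong) auto
qed

lemma nabla_sum_conv_fps:
  assumes "\<beta> > 0"
  shows "nabla_sum a \<beta> f (a + real n) = fps_nth (fps_neg_binomial \<beta> * grid_fps a f) n"
proof -
  have "1 / Gamma \<beta> *
          (rising_factorial (a + real n - backward_jump (a + real k)) (\<beta> - 1) * y) =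
        fps_nth (fps_neg_binomial \<beta>) (n - k) * y" if "k \<le> n" for k y
    using that
    by (simp add: fps_neg_binomial_nth_conv_Gamma[OF assms] rising_factorial_def
        backward_jump_def of_nat_diff algebra_simps)
  thus ?thesis
    unfolding nabla_sum_def sum_Nat_from_upto grid_fps_mult_nth sum_distrib_left
    by (intro sum.cong) auto
qed

lemma grid_fps_diamond_sum:
  assumes "\<alpha> > 0" and "\<beta> > 0"
  shows "grid_fps a (diamond_sum \<gamma> a \<alpha> \<beta> f) =
           (fps_const \<gamma> * fps_neg_binomial \<alpha> + fps_const (1 - \<gamma>) * fps_neg_binomial \<beta>) *
           grid_fps a f"
proof (rule fps_ext)
  fix n
  show "fps_nth (grid_fps a (diamond_sum \<gamma> a \<alpha> \<beta> f)) n =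
          fps_nth ((fps_const \<gamma> * fps_neg_binomial \<alpha> + fps_const (1 - \<gamma>) * fps_neg_binomial \<beta>) *
             grid_fps a f) n"
    unfolding distrib_right mult.assoc fps_add_nth fps_mult_left_const_nth
    by (simp add: grid_fps_def[of a "diamond_sum \<gamma> a \<alpha> \<beta> f"] diamond_sum_def
        delta_sum_conv_fps[OF assms(1)] nabla_sum_conv_fps[OF assms(2)])
qed

theorem theorem3p9:
  fixes a \<gamma> \<alpha>1 \<alpha>2 \<beta>1 \<beta>2 t :: real
    and f :: "real \<Rightarrow> real"
  assumes "\<gamma> \<in> {0..1}"
    and "\<alpha>1 > 0" and "\<alpha>2 > 0" and "\<beta>1 > 0" and "\<beta>2 > 0"
    and "t \<in> Nat_from a"
  shows "diamond_sum \<gamma> a \<alpha>1 \<beta>1 (diamond_sum \<gamma> a \<alpha>2 \<beta>2 f) t =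
           \<gamma> * diamond_sum \<gamma> a (\<alpha>1 + \<alpha>2) (\<beta>1 + \<alpha>2) f t
         + (1 - \<gamma>) * diamond_sum \<gamma> a (\<alpha>1 + \<beta>2) (\<beta>1 + \<beta>2) f t"
proof -
  obtain n where t: "t = a + real n"
    using assms(6) by (auto simp: Nat_from_def)
  have at_t: "g t = fps_nth (grid_fps a g) n" for g
    by (simp add: grid_fps_def t)
  have "grid_fps a (diamond_sum \<gamma> a \<alpha>1 \<beta>1 (diamond_sum \<gamma> a \<alpha>2 \<beta>2 f)) =
          fps_const \<gamma> * grid_fps a (diamond_sum \<gamma> a (\<alpha>1 + \<alpha>2) (\<beta>1 + \<alpha>2) f)
        + fps_const (1 - \<gamma>) * grid_fps a (diamond_sum \<gamma> a (\<alpha>1 + \<beta>2) (\<beta>1 + \<beta>2) f)"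
    using assms(2-5)
    by (simp only: grid_fps_diamond_sum add_pos_pos fps_neg_binomial_add distrib_left
        distrib_right mult_ac add_ac)
  thus ?thesis
    by (simp only: at_t fps_add_nth fps_mult_left_const_nth)
qed

end
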